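(* Let $b\ge2$ and $d\ge b$ be integers, let $p=(p_0,\dots,p_{d-1})$ be a probability vector with positive entries, and let $\eta=\eta_{b,p}$ be the associated Bernoulli convolution. Let $a=\left\lceil\frac{d-1}{b-1}\right\rceil-1$ and let $M_0,\dots,M_{b-1}$ be the $(a+1)\times(a+1)$ matrices $M_j=(p_{j+bq-q'})_{0\le q\le a,\ 0\le q'\le a}$ (row index $q$, column index $q'$, with $p_i=0$ for $i\notin\{0,\dots,d-1\}$). For all $q\in\{0,1,\dots,a\}$, all $k\ge1$ and all $\varepsilon_1,\dots,\varepsilon_k\in\{0,1,\dots,b-1\}$, $$\eta(q+I_{\varepsilon_1\dots\varepsilon_k})=E_qM_{\varepsilon_1}\cdots M_{\varepsilon_k}C,$$ where $I_{\varepsilon_1\dots\varepsilon_k}=\Big[\sum_{i=1}^k\frac{\varepsilon_i}{b^i},\ \sum_{i=1}^k\frac{\varepsilon_i}{b^i}+\frac1{b^k}\Big)$, $E_0,\dots,E_a$ are the canonical basis $(a+1)$-dimensional row vectors, and $C$ is the unique positive eigenvector of the irreducible matrix $\sum_iM_i$ such that $\sum_iE_iC=1$. Consequently, the measures $\eta_{q,symb}$ and $\eta_{sum,symb}$ are linearly representable.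
   Context: $\mathbb N=\{1,2,\dots\}$. The Bernoulli convolution is the probability measure on $\mathbb R$ defined by $\eta_{b,p}(I)=P_p\big(\{(\omega_k)_{k\in\mathbb N}: 0\le\omega_k\le d-1,\ \sum_{k\ge1}\omega_kb^{-k}\in I\}\big)$ for every interval $I$, where $P_p$ is the product probability on $\{0,\dots,d-1\}^{\mathbb N}$ determined by $p$. On $\{0,\dots,b-1\}^{\mathbb N}$, with cylinder sets $[\varepsilon_1\dots\varepsilon_k]$ (sequences beginning with $\varepsilon_1\dots\varepsilon_k$), one defines the probability measures $$\eta_{q,symb}[\varepsilon_1\dots\varepsilon_k]:=\frac{\eta(q+I_{\varepsilon_1\dots\varepsilon_k})}{\eta(q+[0,1))},\qquad \eta_{sum,symb}[\varepsilon_1\dots\varepsilon_k]:=\sum_{q=0}^\infty\eta(q+I_{\varepsilon_1\dots\varepsilon_k}),$$ the first for integers $q\ge0$ with $\eta(q+[0,1))>0$ (i.e. $0\le q\le a$). A probability measure $\nu$ on $\{0,\dots,b-1\}^{\mathbb N}$ is linearly representable if there exist $r\ge1$, nonnegative $r$-dimensional row vectors $R_0,\dots,R_{b-1}$, nonnegative $r\times r$ matrices $A_0,\dots,A_{b-1}$ and a column vector $D$ of dimension $r$ with positive entries such that $(\sum_iR_i)D=1$, $(\sum_iA_i)D=D$ and $\nu[\omega_1\dots\omega_n]=R_{\omega_1}A_{\omega_2}\cdots A_{\omega_n}D$ for all $n\ge 1$ and all $\omega_1,\dots,\omega_n$. *)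

theory Defs
  imports
    "HOL-Probability.Probability"
    "Jordan_Normal_Form.Char_Poly"
begin

unbundle no vec_syntax
unbundle no inner_syntax

text \<open>
  Sequences are indexed from \<open>0\<close>: the entry \<open>\<omega> k\<close> stands for the digit
  usually written \<open>\<omega>\<^sub>k\<^sub>+\<^sub>1\<close>, whose weight is \<open>b\<close> to the power \<open>-(k+1)\<close>.
\<close>

definition digit_product :: "nat \<Rightarrow> (nat \<Rightarrow> real) \<Rightarrow> (nat \<Rightarrow> nat) measure" where
  "digit_product d p = (\<Pi>\<^sub>M k\<in>(UNIV :: nat set). point_measure {0..<d} (\<lambda>i. ennreal (p i)))"

definition bernoulli_conv :: "nat \<Rightarrow> nat \<Rightarrow> (nat \<Rightarrow> real) \<Rightarrow> real measure" where
  "bernoulli_conv b d p =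
     distr (digit_product d p) borel (\<lambda>\<omega>. \<Sum>k. real (\<omega> k) / real b ^ Suc k)"

definition adic_interval :: "nat \<Rightarrow> nat list \<Rightarrow> real set" where
  "adic_interval b \<epsilon> =
     (let s = (\<Sum>i<length \<epsilon>. real (\<epsilon> ! i) / real b ^ Suc i)
      in {s ..< s + 1 / real b ^ length \<epsilon>})"

definition translate :: "nat \<Rightarrow> real set \<Rightarrow> real set" where
  "translate q X = (\<lambda>x. real q + x) ` X"

definition prob_ext :: "nat \<Rightarrow> (nat \<Rightarrow> real) \<Rightarrow> int \<Rightarrow> real" where
  "prob_ext d p i = (if 0 \<le> i \<and> i < int d then p (nat i) else 0)"

definition top_index :: "nat \<Rightarrow> nat \<Rightarrow> nat" where
  "top_index b d = nat (\<lceil>(real d - 1) / (real b - 1)\<rceil> - 1)"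

definition digit_mat :: "nat \<Rightarrow> nat \<Rightarrow> (nat \<Rightarrow> real) \<Rightarrow> nat \<Rightarrow> real mat" where
  "digit_mat b d p j =
     mat (top_index b d + 1) (top_index b d + 1)
       (\<lambda>(q, q'). prob_ext d p (int j + int b * int q - int q'))"

definition vec_sum :: "nat \<Rightarrow> nat \<Rightarrow> (nat \<Rightarrow> real vec) \<Rightarrow> real vec" where
  "vec_sum r b R = vec r (\<lambda>i. \<Sum>k<b. R k $ i)"

definition mat_sum :: "nat \<Rightarrow> nat \<Rightarrow> (nat \<Rightarrow> real mat) \<Rightarrow> real mat" where
  "mat_sum r b A = mat r r (\<lambda>(i, j). \<Sum>k<b. A k $$ (i, j))"

definition mat_word :: "nat \<Rightarrow> (nat \<Rightarrow> real mat) \<Rightarrow> nat list \<Rightarrow> real mat" where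
  "mat_word r A w = foldr (\<lambda>j X. A j * X) w (1\<^sub>m r)"

text \<open>
  For nonnegative matrices only; signed matrices would need the definition
  by invariant coordinate subspaces.
\<close>

definition irreducible_mat :: "nat \<Rightarrow> real mat \<Rightarrow> bool" where
  "irreducible_mat n A \<longleftrightarrow>
     A \<in> carrier_mat n n \<and> 0\<^sub>m n n \<le> A \<and>
     (\<forall>i<n. \<forall>j<n. \<exists>k\<ge>1. 0 < (A ^\<^sub>m k) $$ (i, j))"

definition positive_vec :: "nat \<Rightarrow> real vec \<Rightarrow> bool" where
  "positive_vec n v \<longleftrightarrow> v \<in> carrier_vec n \<and> (\<forall>i<n. 0 < v $ i)"

text \<open>
  The eigenvalue is not prescribed; a row vector times a column vector is
  written as a scalar product.
\<close>

definition normalized_positive_eigenvector :: "nat \<Rightarrow> real mat \<Rightarrow> real vec \<Rightarrow> bool" where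
  "normalized_positive_eigenvector n A C \<longleftrightarrow>
     positive_vec n C \<and> (\<exists>l. eigenvector A C l) \<and> (\<Sum>i<n. unit_vec n i \<bullet> C) = 1"

definition symb_space :: "nat \<Rightarrow> (nat \<Rightarrow> nat) measure" where
  "symb_space b = (\<Pi>\<^sub>M k\<in>(UNIV :: nat set). count_space {0..<b})"

definition cylinder :: "nat \<Rightarrow> nat list \<Rightarrow> (nat \<Rightarrow> nat) set" where
  "cylinder b w = {\<omega> \<in> space (symb_space b). \<forall>i<length w. \<omega> i = w ! i}"

definition symb_prob :: "nat \<Rightarrow> (nat \<Rightarrow> nat) measure \<Rightarrow> bool" where
  "symb_prob b \<nu> \<longleftrightarrow> prob_space \<nu> \<and> sets \<nu> = sets (symb_space b)"

definition has_cylinder_values :: "nat \<Rightarrow> (nat list \<Rightarrow> real) \<Rightarrow> (nat \<Rightarrow> nat) measure \<Rightarrow> bool" where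
  "has_cylinder_values b f \<nu> \<longleftrightarrow>
     symb_prob b \<nu> \<and>
     (\<forall>w. w \<noteq> [] \<and> set w \<subseteq> {0..<b} \<longrightarrow> measure \<nu> (cylinder b w) = f w)"

text \<open>Only meaningful when exactly one probability measure has the given cylinder values.\<close>

definition cylinder_measure :: "nat \<Rightarrow> (nat list \<Rightarrow> real) \<Rightarrow> (nat \<Rightarrow> nat) measure" where
  "cylinder_measure b f = (THE \<nu>. has_cylinder_values b f \<nu>)"

definition eta_q_values :: "nat \<Rightarrow> nat \<Rightarrow> (nat \<Rightarrow> real) \<Rightarrow> nat \<Rightarrow> nat list \<Rightarrow> real" where
  "eta_q_values b d p q w =
     measure (bernoulli_conv b d p) (translate q (adic_interval b w)) /
     measure (bernoulli_conv b d p) (translate q {0..<1})"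

definition eta_sum_values :: "nat \<Rightarrow> nat \<Rightarrow> (nat \<Rightarrow> real) \<Rightarrow> nat list \<Rightarrow> real" where
  "eta_sum_values b d p w =
     (\<Sum>q. measure (bernoulli_conv b d p) (translate q (adic_interval b w)))"

definition eta_q_symb :: "nat \<Rightarrow> nat \<Rightarrow> (nat \<Rightarrow> real) \<Rightarrow> nat \<Rightarrow> (nat \<Rightarrow> nat) measure" where
  "eta_q_symb b d p q = cylinder_measure b (eta_q_values b d p q)"

definition eta_sum_symb :: "nat \<Rightarrow> nat \<Rightarrow> (nat \<Rightarrow> real) \<Rightarrow> (nat \<Rightarrow> nat) measure" where
  "eta_sum_symb b d p = cylinder_measure b (eta_sum_values b d p)"

definition linearly_representable :: "nat \<Rightarrow> (nat \<Rightarrow> nat) measure \<Rightarrow> bool" where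
  "linearly_representable b \<nu> \<longleftrightarrow>
     symb_prob b \<nu> \<and>
     (\<exists>r\<ge>1. \<exists>R A D.
        (\<forall>i<b. R i \<in> carrier_vec r \<and> 0\<^sub>v r \<le> R i) \<and>
        (\<forall>i<b. A i \<in> carrier_mat r r \<and> 0\<^sub>m r r \<le> A i) \<and>
        positive_vec r D \<and>
        vec_sum r b R \<bullet> D = 1 \<and>
        mat_sum r b A *\<^sub>v D = D \<and>
        (\<forall>w. w \<noteq> [] \<and> set w \<subseteq> {0..<b} \<longrightarrow>
           measure \<nu> (cylinder b w) = R (hd w) \<bullet> (mat_word r A (tl w) *\<^sub>v D)))"

end

theory Submission
  imports Defs
begin

text \<open>
A random expansion with digits below \<open>d\<close> is \<open>(i + y) / b\<close> with first digit \<open>i\<close> and an independent copy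
\<open>y\<close> of itself. It lies in the translate by \<open>q\<close> of the \<open>b\<close>-adic cell of a word \<open>e # w\<close> iff
\<open>y\<close> lies in the translate by \<open>q' = e + b q - i\<close> of the cell of \<open>w\<close>. Almost surely
\<open>0 \<le> y < (d - 1) / (b - 1)\<close>, so only \<open>q' \<in> {0..a}\<close> contributes, and the vector of the masses of the
\<open>a + 1\<close> translates of the cell of \<open>e # w\<close> is the matrix \<open>M\<^sub>e\<close> times the same vector for \<open>w\<close>
(\<open>bernoulli_conv_self_similar\<close>, \<open>AE_support\<close>, \<open>cell_mass_Cons\<close>). Iterating down to the empty word leaves
the vector \<open>C\<close> of the masses of the intervals \<open>[q, q + 1)\<close>.

These intervals carry the whole measure, so the entries of \<open>C\<close> sum to \<open>1\<close>, and splitting each into its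
\<open>b\<close> cells of length one shows that \<open>C\<close> is fixed by \<open>\<Sum>\<^sub>i M\<^sub>i\<close>. The latter matrix is positive on and next to the
diagonal, hence irreducible, so a nonnegative fixed vector other than zero is positive and is unique up to
scaling (\<open>irreducible_fixed_vec_pos\<close>, \<open>irreducible_fixed_vec_unique\<close>). This makes
every interval \<open>[q, q + 1)\<close> with \<open>q \<le> a\<close> charged. The columns of the matrix sum to \<open>1\<close>,
so every positive eigenvector belongs to the eigenvalue \<open>1\<close> and \<open>C\<close> is the normalized one.

The symbolic measures are the laws of the digit sequence of the fractional part of a random point,
under \<open>\<eta>\<close> conditioned on \<open>[q, q + 1)\<close> and under \<open>\<eta>\<close> itself. Their cylinder values are
\<open>u M\<^sub>w C\<close>, with \<open>u\<close> a multiple of a unit vector in the first case and the all-ones vector in the second;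
such a formula is a linear representation once the first matrix of the product is absorbed into \<open>u\<close>.
\<close>

section \<open>Irreducible and column stochastic matrices\<close>

lemma mult_mat_vec_nth:
  fixes A :: "real mat"
  assumes "A \<in> carrier_mat n n" "v \<in> carrier_vec n" "i < n"
  shows "(A *\<^sub>v v) $ i = (\<Sum>j<n. A $$ (i, j) * v $ j)"
  using assms by (auto simp: scalar_prod_def atLeast0LessThan intro!: sum.cong)

lemma mult_mat_nth:
  fixes A :: "real mat"
  assumes "A \<in> carrier_mat n n" "B \<in> carrier_mat n n" "i < n" "j < n"
  shows "(A * B) $$ (i, j) = (\<Sum>l<n. A $$ (i, l) * B $$ (l, j))"
  using assms by (auto simp: scalar_prod_def atLeast0LessThan intro!: sum.cong)

lemma pow_mat_nonneg:
  fixes A :: "real mat"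
  assumes A: "A \<in> carrier_mat n n" "0\<^sub>m n n \<le> A" and "i < n" "j < n"
  shows "0 \<le> (A ^\<^sub>m k) $$ (i, j)"
  using \<open>j < n\<close>
proof (induction k arbitrary: j)
  case 0
  then show ?case using A \<open>i < n\<close> by auto
next
  case (Suc k)
  have "(A ^\<^sub>m Suc k) $$ (i, j) = (\<Sum>l<n. (A ^\<^sub>m k) $$ (i, l) * A $$ (l, j))"
    using mult_mat_nth[of "A ^\<^sub>m k" n A i j] A \<open>i < n\<close> Suc.prems by simp
  also have "\<dots> \<ge> 0"
    using A Suc by (intro sum_nonneg mult_nonneg_nonneg) (auto simp: less_eq_mat_def)
  finally show ?case .
qed

lemma pow_mat_fixed_vec:
  fixes A :: "real mat"
  assumes A: "A \<in> carrier_mat n n" and v: "v \<in> carrier_vec n" and fix_v: "A *\<^sub>v v = v"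
  shows "(A ^\<^sub>m k) *\<^sub>v v = v"
proof (induction k)
  case (Suc k)
  have "(A ^\<^sub>m k * A) *\<^sub>v v = A ^\<^sub>m k *\<^sub>v (A *\<^sub>v v)"
    using A v by (intro assoc_mult_mat_vec[of _ n n _ n]) auto
  then show ?case using Suc fix_v by simp
qed (use A v in auto)

text \<open>
Positivity spreads along powers: some power of the matrix has a positive entry at \<open>(i, j)\<close>,
and \<open>v\<close> is fixed by that power too, so \<open>v $ i\<close> is at least this entry times \<open>v $ j\<close>.
\<close>

lemma irreducible_fixed_vec_pos:
  assumes irr: "irreducible_mat n A" and v: "v \<in> carrier_vec n" and fix_v: "A *\<^sub>v v = v"
    and nonneg: "\<And>i. i < n \<Longrightarrow> 0 \<le> v $ i" and "j < n" "0 < v $ j" and "i < n"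
  shows "0 < v $ i"
proof -
  have A: "A \<in> carrier_mat n n" "0\<^sub>m n n \<le> A"
    using irr by (auto simp: irreducible_mat_def)
  obtain k where k: "0 < (A ^\<^sub>m k) $$ (i, j)"
    using irr \<open>i < n\<close> \<open>j < n\<close> by (auto simp: irreducible_mat_def)
  have "0 < (A ^\<^sub>m k) $$ (i, j) * v $ j"
    using k \<open>0 < v $ j\<close> by simp
  also have "\<dots> \<le> (\<Sum>l<n. (A ^\<^sub>m k) $$ (i, l) * v $ l)"
    using \<open>i < n\<close> \<open>j < n\<close> nonneg pow_mat_nonneg[OF A]
    by (intro member_le_sum) auto
  also have "\<dots> = v $ i"
    using mult_mat_vec_nth[of "A ^\<^sub>m k" n v i] pow_mat_fixed_vec[OF A(1) v fix_v] A v \<open>i < n\<close> by simp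
  finally show ?thesis .
qed

text \<open>
The uniqueness half of the Perron--Frobenius theorem: subtract the largest multiple of \<open>D\<close> that keeps
the difference \<open>C - t D\<close> nonnegative. The difference is fixed and has a zero entry, so by the
previous lemma it has no positive entry at all, and the normalization forces \<open>t = 1\<close>.
\<close>

lemma irreducible_fixed_vec_unique:
  assumes irr: "irreducible_mat n A"
    and C: "positive_vec n C" "A *\<^sub>v C = C" "(\<Sum>i<n. C $ i) = 1"
    and D: "positive_vec n D" "A *\<^sub>v D = D" "(\<Sum>i<n. D $ i) = 1"
  shows "C = D"
proof -
  have A: "A \<in> carrier_mat n n" using irr by (auto simp: irreducible_mat_def)
  have cC: "C \<in> carrier_vec n" and cD: "D \<in> carrier_vec n"
    and pC: "\<And>i. i < n \<Longrightarrow> 0 < C $ i" and pD: "\<And>i. i < n \<Longrightarrow> 0 < D $ i"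
    using C D by (auto simp: positive_vec_def)
  have "n \<noteq> 0" using C(3) by (cases n) auto
  define t where "t = Min ((\<lambda>i. C $ i / D $ i) ` {..<n})"
  have t_le: "t \<le> C $ i / D $ i" if "i < n" for i
    unfolding t_def using that by (intro Min_le) auto
  have "t \<in> (\<lambda>i. C $ i / D $ i) ` {..<n}"
    unfolding t_def using \<open>n \<noteq> 0\<close> by (intro Min_in) auto
  then obtain m where m: "m < n" "t = C $ m / D $ m" by auto
  define v where "v = C - t \<cdot>\<^sub>v D"
  have v: "v \<in> carrier_vec n" using cC cD by (auto simp: v_def)
  have v_nth: "v $ i = C $ i - t * D $ i" if "i < n" for i
    using that cC cD by (auto simp: v_def)
  have "A *\<^sub>v v = A *\<^sub>v C - A *\<^sub>v (t \<cdot>\<^sub>v D)"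
    unfolding v_def using A cC cD by (intro mult_minus_distrib_mat_vec) auto
  also have "A *\<^sub>v (t \<cdot>\<^sub>v D) = t \<cdot>\<^sub>v D"
    using mult_mat_vec[OF A cD] D(2) by simp
  finally have fix_v: "A *\<^sub>v v = v" using C(2) by (simp add: v_def)
  have nonneg: "0 \<le> v $ i" if "i < n" for i
    using t_le[OF that] pD[OF that] that by (simp add: v_nth field_simps)
  have "v $ m = 0" using m pD[of m] by (simp add: v_nth)
  have zero: "C $ i = t * D $ i" if "i < n" for i
  proof (rule ccontr)
    assume "C $ i \<noteq> t * D $ i"
    then have "0 < v $ i" using nonneg[OF that] by (simp add: v_nth that)
    from irreducible_fixed_vec_pos[OF irr v fix_v nonneg that this \<open>m < n\<close>] \<open>v $ m = 0\<close>
    show False by simp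
  qed
  have "(\<Sum>i<n. C $ i) = t * (\<Sum>i<n. D $ i)"
    by (simp add: sum_distrib_left zero)
  then have "t = 1" using C D by simp
  then show ?thesis using zero cC cD by (intro eq_vecI) auto
qed

text \<open>
Multiplication by a matrix with unit column sums preserves the sum of the entries, which leaves \<open>1\<close> as the
only eigenvalue of an eigenvector whose entries do not sum to zero.
\<close>

lemma column_stochastic_eigenvalue:
  fixes A :: "real mat"
  assumes A: "A \<in> carrier_mat n n" and col: "\<And>j. j < n \<Longrightarrow> (\<Sum>i<n. A $$ (i, j)) = 1"
    and v: "v \<in> carrier_vec n" and sum_v: "(\<Sum>i<n. v $ i) \<noteq> 0" and ev: "eigenvector A v l"
  shows "A *\<^sub>v v = v"
proof -
  have Av: "A *\<^sub>v v = l \<cdot>\<^sub>v v" using ev by (simp add: eigenvector_def)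
  have "l * (\<Sum>i<n. v $ i) = (\<Sum>i<n. (A *\<^sub>v v) $ i)"
    unfolding Av using v by (simp add: sum_distrib_left)
  also have "\<dots> = (\<Sum>i<n. \<Sum>j<n. A $$ (i, j) * v $ j)"
    by (intro sum.cong) (use mult_mat_vec_nth[OF A v] in auto)
  also have "\<dots> = (\<Sum>j<n. (\<Sum>i<n. A $$ (i, j)) * v $ j)"
    by (subst sum.swap) (simp add: sum_distrib_right)
  also have "\<dots> = (\<Sum>j<n. v $ j)" by (simp add: col)
  finally have "l = 1" using sum_v by simp
  then show ?thesis using Av by simp
qed

text \<open>
A walk can stay where it is or move to a neighbouring index, so in \<open>k\<close> steps it connects any two
indices at distance at most \<open>k\<close>.
\<close>

lemma irreducible_mat_band:
  assumes A: "A \<in> carrier_mat n n" "0\<^sub>m n n \<le> A"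
    and band: "\<And>i j. i < n \<Longrightarrow> j < n \<Longrightarrow> i \<le> Suc j \<Longrightarrow> j \<le> Suc i \<Longrightarrow> 0 < A $$ (i, j)"
  shows "irreducible_mat n A"
proof -
  have pos: "0 < (A ^\<^sub>m k) $$ (i, j)" if "i < n" "j < n" "i \<le> j + k" "j \<le> i + k" for i j k
    using that
  proof (induction k arbitrary: j)
    case 0
    then show ?case using A by auto
  next
    case (Suc k)
    \<comment> \<open>the last intermediate index of a walk from \<open>i\<close> to \<open>j\<close>: next to \<open>j\<close> on the side of \<open>i\<close> when \<open>k\<close> steps do not reach \<open>j\<close>\<close>
    define l where "l = (if i + k < j then j - 1 else if j + k < i then j + 1 else j)"
    have l: "l < n" "i \<le> l + k" "l \<le> i + k" "l \<le> Suc j" "j \<le> Suc l"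
      using Suc.prems by (auto simp: l_def)
    have "0 < (A ^\<^sub>m k) $$ (i, l) * A $$ (l, j)"
      using Suc.IH[OF Suc.prems(1) l(1-3)] band[OF l(1) Suc.prems(2) l(4,5)] by simp
    also have "\<dots> \<le> (\<Sum>l<n. (A ^\<^sub>m k) $$ (i, l) * A $$ (l, j))"
      using Suc.prems l pow_mat_nonneg[OF A] A by (intro member_le_sum) (auto simp: less_eq_mat_def)
    also have "\<dots> = (A ^\<^sub>m Suc k) $$ (i, j)"
      using mult_mat_nth[of "A ^\<^sub>m k" n A i j] A Suc.prems by simp
    finally show ?case .
  qed
  have "\<exists>k\<ge>1. 0 < (A ^\<^sub>m k) $$ (i, j)" if "i < n" "j < n" for i j
    using pos[OF that, of n] that by (intro exI[of _ n]) auto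
  then show ?thesis using A by (auto simp: irreducible_mat_def)
qed

section \<open>Cells and digits\<close>

text \<open>
The expanding map \<open>x \<mapsto> b x - e\<close> removes the first digit of a cell. Everything about cells
below is an induction along this equivalence.
\<close>

lemma cell_Cons:
  assumes "0 < b"
  shows "x \<in> adic_interval b (e # w) \<longleftrightarrow> real b * x - real e \<in> adic_interval b w"
proof -
  define s where "s = (\<Sum>i<length w. real (w ! i) / real b ^ Suc i)"
  have "(\<Sum>i<length (e # w). real ((e # w) ! i) / real b ^ Suc i) = (real e + s) / real b"
    by (simp add: sum.lessThan_Suc_shift s_def sum_divide_distrib add_divide_distrib field_simps
        del: sum.lessThan_Suc)
  then have "x \<in> adic_interval b (e # w) \<longleftrightarrow>
      (real e + s) / real b \<le> x \<and> x < (real e + s) / real b + 1 / (real b * real b ^ length w)"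
    unfolding adic_interval_def Let_def by simp
  also have "(real e + s) / real b + 1 / (real b * real b ^ length w) =
      (real e + s + 1 / real b ^ length w) / real b"
    using assms by (simp add: field_simps)
  also have "((real e + s) / real b \<le> x \<and> x < (real e + s + 1 / real b ^ length w) / real b) \<longleftrightarrow>
      (real e + s \<le> real b * x \<and> real b * x < real e + s + 1 / real b ^ length w)"
    using assms by (simp add: pos_divide_le_eq pos_less_divide_eq mult.commute)
  also have "\<dots> \<longleftrightarrow> real b * x - real e \<in> adic_interval b w"
    unfolding adic_interval_def Let_def s_def[symmetric] by auto
  finally show ?thesis .
qed

lemma cell_Nil: "adic_interval b [] = {0..<1}"
  by (simp add: adic_interval_def)

lemma cell_unit:
  assumes "0 < b" "set w \<subseteq> {0..<b}" "x \<in> adic_interval b w"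
  shows "0 \<le> x" "x < 1"
proof -
  have "0 \<le> x \<and> x < 1"
    using assms(2,3)
  proof (induction w arbitrary: x)
    case (Cons e w)
    have "0 \<le> real b * x - real e" "real b * x - real e < 1"
      using Cons.IH[of "real b * x - real e"] Cons.prems cell_Cons[OF \<open>0 < b\<close>] by auto
    moreover have "real e + 1 \<le> real b"
      using Cons.prems by auto
    ultimately have "0 \<le> real b * x" "real b * x < real b * 1" by linarith+
    then show ?case using \<open>0 < b\<close> by (simp add: zero_le_mult_iff)
  qed (simp add: cell_Nil)
  then show "0 \<le> x" "x < 1" by auto
qed

lemma cell_borel [measurable]: "adic_interval b w \<in> sets borel"
  by (simp add: adic_interval_def Let_def)

text \<open>
The digits after the radix point. The reduction modulo \<open>b\<close> makes them depend only on the
fractional part of \<open>x\<close>, so that one coding map serves all translates of the unit interval.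
\<close>

definition adic_digit :: "nat \<Rightarrow> real \<Rightarrow> nat \<Rightarrow> nat" where
  "adic_digit b x k = nat (\<lfloor>real b ^ Suc k * x\<rfloor> mod int b)"

lemma adic_digit_less: "0 < b \<Longrightarrow> adic_digit b x k < b"
  by (simp add: adic_digit_def nat_less_iff)

lemma adic_digit_minus_int: "adic_digit b (x - real_of_int m) k = adic_digit b x k"
proof -
  have "real b ^ Suc k * (x - real_of_int m) = real b ^ Suc k * x - real_of_int (int b ^ Suc k * m)"
    by (simp add: algebra_simps)
  then have "\<lfloor>real b ^ Suc k * (x - real_of_int m)\<rfloor> = \<lfloor>real b ^ Suc k * x\<rfloor> - int b ^ Suc k * m"
    by (simp only: floor_diff_of_int)
  also have "\<dots> mod int b = \<lfloor>real b ^ Suc k * x\<rfloor> mod int b"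
    using mod_mult_self2[of "\<lfloor>real b ^ Suc k * x\<rfloor>" "int b" "- (int b ^ k * m)"]
    by (simp add: mult.assoc)
  finally show ?thesis by (simp add: adic_digit_def)
qed

lemma adic_digit_Suc: "adic_digit b x (Suc k) = adic_digit b (real b * x) k"
  by (simp add: adic_digit_def algebra_simps)

lemma cell_iff_digits:
  assumes b: "0 < b" and "set w \<subseteq> {0..<b}" "0 \<le> x" "x < 1"
  shows "x \<in> adic_interval b w \<longleftrightarrow> (\<forall>i<length w. adic_digit b x i = w ! i)"
  using assms(2-)
proof (induction w arbitrary: x)
  case Nil
  then show ?case by (simp add: cell_Nil)
next
  case (Cons e w)
  define y where "y = real b * x - real e"
  have w: "set w \<subseteq> {0..<b}" and e: "e < b" using Cons.prems by auto
  have "0 \<le> \<lfloor>real b * x\<rfloor>" "\<lfloor>real b * x\<rfloor> < int b"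
    using Cons.prems b by (auto simp: floor_less_iff)
  then have "adic_digit b x 0 = e \<longleftrightarrow> \<lfloor>real b * x\<rfloor> = int e"
    by (auto simp: adic_digit_def)
  also have "\<dots> \<longleftrightarrow> 0 \<le> y \<and> y < 1"
    by (auto simp: y_def floor_eq_iff)
  finally have head: "adic_digit b x 0 = e \<longleftrightarrow> 0 \<le> y \<and> y < 1" .
  have tail: "adic_digit b x (Suc i) = adic_digit b y i" for i
    using adic_digit_minus_int[of b "real b * x" "int e" i] by (simp add: y_def adic_digit_Suc)
  have "x \<in> adic_interval b (e # w) \<longleftrightarrow> y \<in> adic_interval b w"
    using cell_Cons[OF b] by (simp add: y_def)
  also have "\<dots> \<longleftrightarrow> (0 \<le> y \<and> y < 1) \<and> (\<forall>i<length w. adic_digit b y i = w ! i)"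
    using Cons.IH[OF w, of y] cell_unit[OF b w, of y] by blast
  also have "\<dots> \<longleftrightarrow> (\<forall>i<length (e # w). adic_digit b x i = (e # w) ! i)"
    unfolding head[symmetric] tail[symmetric] by (simp add: All_less_Suc2)
  finally show ?case .
qed

lemma space_symb_space: "space (symb_space b) = {\<omega>. \<forall>k. \<omega> k < b}"
  by (auto simp: symb_space_def space_PiM PiE_def Pi_def)

lemma adic_digit_measurable [measurable]:
  assumes "0 < b"
  shows "adic_digit b \<in> measurable borel (symb_space b)"
  unfolding symb_space_def
proof (rule measurable_PiM_single')
  fix k :: nat
  have *: "(\<lambda>x. adic_digit b x k) \<in> measurable borel (count_space UNIV)"
    unfolding adic_digit_def by measurable
  show "(\<lambda>x. adic_digit b x k) \<in> measurable borel (count_space {0..<b})"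
    using measurable_sets[OF *] adic_digit_less[OF assms]
    by (auto simp: measurable_count_space_eq2)
qed (auto simp: adic_digit_less[OF assms])

lemma cylinder_sets [measurable]: "cylinder b w \<in> sets (symb_space b)"
proof -
  have "{\<omega> \<in> space (symb_space b). \<omega> i = c} \<in> sets (symb_space b)" for i c
  proof -
    have "(\<lambda>\<omega>. \<omega> i) \<in> measurable (symb_space b) (count_space {0..<b})"
      unfolding symb_space_def by measurable
    then have "(\<lambda>\<omega>. \<omega> i) -` ({c} \<inter> {0..<b}) \<inter> space (symb_space b) \<in> sets (symb_space b)"
      by (rule measurable_sets) auto
    also have "(\<lambda>\<omega>. \<omega> i) -` ({c} \<inter> {0..<b}) \<inter> space (symb_space b) =
        {\<omega> \<in> space (symb_space b). \<omega> i = c}"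
      by (auto simp: space_symb_space)
    finally show ?thesis .
  qed
  then have "{\<omega> \<in> space (symb_space b). \<forall>i\<in>{..<length w}. \<omega> i = w ! i} \<in> sets (symb_space b)"
    by (intro sets.sets_Collect_finite_All) auto
  also have "{\<omega> \<in> space (symb_space b). \<forall>i\<in>{..<length w}. \<omega> i = w ! i} = cylinder b w"
    by (auto simp: cylinder_def)
  finally show ?thesis .
qed

lemma digits_in_cylinder_borel:
  assumes "0 < b"
  shows "{x. adic_digit b x \<in> cylinder b w} \<in> sets borel"
  using measurable_sets[OF adic_digit_measurable[OF assms] cylinder_sets, of w]
  by (simp add: vimage_def)

lemma digits_in_cylinder_iff:
  assumes "0 < b" "set w \<subseteq> {0..<b}"
  shows "adic_digit b x \<in> cylinder b w \<longleftrightarrow> (\<exists>m::int. x - of_int m \<in> adic_interval b w)"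
    and "real_of_int m \<le> x \<Longrightarrow> x < real_of_int m + 1 \<Longrightarrow>
      adic_digit b x \<in> cylinder b w \<longleftrightarrow> x - of_int m \<in> adic_interval b w"
proof -
  have *: "adic_digit b x \<in> cylinder b w \<longleftrightarrow> x - of_int m \<in> adic_interval b w"
    if "real_of_int m \<le> x" "x < real_of_int m + 1" for m
    using that cell_iff_digits[OF assms, of "x - of_int m"] adic_digit_less[OF assms(1)]
    by (simp add: adic_digit_minus_int cylinder_def space_symb_space)
  show "real_of_int m \<le> x \<Longrightarrow> x < real_of_int m + 1 \<Longrightarrow>
      adic_digit b x \<in> cylinder b w \<longleftrightarrow> x - of_int m \<in> adic_interval b w"
    by (rule *)
  show "adic_digit b x \<in> cylinder b w \<longleftrightarrow> (\<exists>m::int. x - of_int m \<in> adic_interval b w)"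
  proof
    assume "\<exists>m::int. x - of_int m \<in> adic_interval b w"
    then obtain m :: int where m: "x - of_int m \<in> adic_interval b w" by blast
    with cell_unit[OF assms m] *[of m] show "adic_digit b x \<in> cylinder b w" by auto
  next
    assume "adic_digit b x \<in> cylinder b w"
    then show "\<exists>m::int. x - of_int m \<in> adic_interval b w"
      using *[of "\<lfloor>x\<rfloor>"] by auto
  qed
qed

text \<open>
A finite-dimensional box is the disjoint union of the cylinders of the words of length \<open>n\<close> that
it contains, as soon as \<open>n\<close> exceeds all constrained coordinates; and boxes determine a finite measure.
\<close>

lemma has_cylinder_values_unique:
  assumes "has_cylinder_values b f \<mu>" "has_cylinder_values b f \<nu>"
  shows "\<mu> = \<nu>"
proof (rule measure_eqI_PiM_infinite)
  have sets_eq: "sets \<mu> = sets (symb_space b)" "sets \<nu> = sets (symb_space b)"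
    and prob: "prob_space \<mu>" "prob_space \<nu>"
    and val: "\<And>w. w \<noteq> [] \<Longrightarrow> set w \<subseteq> {0..<b} \<Longrightarrow> measure \<mu> (cylinder b w) = f w"
      "\<And>w. w \<noteq> [] \<Longrightarrow> set w \<subseteq> {0..<b} \<Longrightarrow> measure \<nu> (cylinder b w) = f w"
    using assms by (auto simp: has_cylinder_values_def symb_prob_def)
  show "sets \<mu> = sets (\<Pi>\<^sub>M k\<in>(UNIV :: nat set). count_space {0..<b})"
    "sets \<nu> = sets (\<Pi>\<^sub>M k\<in>(UNIV :: nat set). count_space {0..<b})"
    using sets_eq by (simp_all add: symb_space_def)
  show "finite_measure \<mu>" using prob by (simp add: prob_space_def)
  fix A :: "nat \<Rightarrow> nat set" and J :: "nat set"
  assume J: "finite J" and A: "\<And>i. i \<in> J \<Longrightarrow> A i \<in> sets (count_space {0..<b})"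
  \<comment> \<open>the successor keeps the words nonempty even when \<open>J\<close> is empty\<close>
  define n where "n = Suc (Max (insert 0 J))"
  have n: "j < n" if "j \<in> J" for j
    using J that by (auto simp: n_def less_Suc_eq_le)
  define W where "W = {w. set w \<subseteq> {0..<b} \<and> length w = n \<and> (\<forall>j\<in>J. w ! j \<in> A j)}"
  define B where "B = prod_emb UNIV (\<lambda>_. count_space {0..<b}) J (Pi\<^sub>E J A)"
  have "finite W"
    by (rule finite_subset[OF _ finite_lists_length_eq[of "{0..<b}" n]]) (auto simp: W_def)
  have B: "B = (\<Union>w\<in>W. cylinder b w)"
  proof (intro Set.set_eqI iffI)
    fix \<omega> assume "\<omega> \<in> B"
    then have \<omega>: "\<And>k. \<omega> k < b" "\<And>j. j \<in> J \<Longrightarrow> \<omega> j \<in> A j"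
      by (auto simp: B_def prod_emb_def PiE_def Pi_def)
    then have "map \<omega> [0..<n] \<in> W" using n by (auto simp: W_def)
    moreover have "\<omega> \<in> cylinder b (map \<omega> [0..<n])"
      using \<omega> by (auto simp: cylinder_def space_symb_space)
    ultimately show "\<omega> \<in> (\<Union>w\<in>W. cylinder b w)" by blast
  next
    fix \<omega> assume "\<omega> \<in> (\<Union>w\<in>W. cylinder b w)"
    then obtain w where w: "w \<in> W" "\<omega> \<in> cylinder b w" by blast
    then have "\<omega> j \<in> A j" if "j \<in> J" for j
      using n[OF that] that by (auto simp: cylinder_def W_def)
    then show "\<omega> \<in> B"
      using w by (auto simp: B_def prod_emb_def cylinder_def space_symb_space)
  qed
  have disj: "disjoint_family_on (cylinder b) W"
  proof (clarsimp simp: disjoint_family_on_def)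
    fix v w assume vw: "v \<in> W" "w \<in> W" "v \<noteq> w"
    then obtain i where "i < n" "v ! i \<noteq> w ! i"
      by (auto simp: W_def list_eq_iff_nth_eq)
    with vw show "cylinder b v \<inter> cylinder b w = {}"
      by (auto simp: cylinder_def W_def)
  qed
  have *: "measure \<rho> B = (\<Sum>w\<in>W. f w)"
    if "prob_space \<rho>" "sets \<rho> = sets (symb_space b)"
      "\<And>w. w \<noteq> [] \<Longrightarrow> set w \<subseteq> {0..<b} \<Longrightarrow> measure \<rho> (cylinder b w) = f w" for \<rho>
  proof -
    interpret prob_space \<rho> by fact
    have "measure \<rho> B = (\<Sum>w\<in>W. measure \<rho> (cylinder b w))"
      unfolding B
    proof (rule finite_measure_finite_Union[OF \<open>finite W\<close> _ disj])
      show "cylinder b ` W \<subseteq> sets \<rho>"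
        unfolding that(2) using cylinder_sets by blast
    qed
    also have "\<dots> = (\<Sum>w\<in>W. f w)"
    proof (rule sum.cong[OF refl that(3)])
      fix w assume "w \<in> W"
      then have "length w = n" "set w \<subseteq> {0..<b}" by (auto simp: W_def)
      then show "w \<noteq> []" "set w \<subseteq> {0..<b}" by (auto simp: n_def)
    qed
    finally show ?thesis .
  qed
  interpret \<mu>: prob_space \<mu> by fact
  interpret \<nu>: prob_space \<nu> by fact
  show "emeasure \<mu> (prod_emb UNIV (\<lambda>_. count_space {0..<b}) J (Pi\<^sub>E J A)) =
      emeasure \<nu> (prod_emb UNIV (\<lambda>_. count_space {0..<b}) J (Pi\<^sub>E J A))"
    using *[OF prob(1) sets_eq(1) val(1)] *[OF prob(2) sets_eq(2) val(2)]
    by (simp add: B_def \<mu>.emeasure_eq_measure \<nu>.emeasure_eq_measure)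
qed

lemma has_cylinder_values_distr_digits:
  assumes b: "0 < b" and \<mu>: "prob_space \<mu>" "sets \<mu> = sets borel"
    and val: "\<And>w. w \<noteq> [] \<Longrightarrow> set w \<subseteq> {0..<b} \<Longrightarrow>
      measure \<mu> {x. adic_digit b x \<in> cylinder b w} = f w"
  shows "has_cylinder_values b f (distr \<mu> (symb_space b) (adic_digit b))"
proof -
  interpret prob_space \<mu> by fact
  have meas: "adic_digit b \<in> measurable \<mu> (symb_space b)"
    using adic_digit_measurable[OF b] \<mu>(2) by (simp cong: measurable_cong_sets)
  have "space \<mu> = UNIV" using sets_eq_imp_space_eq[OF \<mu>(2)] by simp
  then show ?thesis
    using val meas
    by (auto simp: has_cylinder_values_def symb_prob_def prob_space_distr measure_distr
        vimage_def)
qed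

section \<open>Products along words and linear representations\<close>

lemma mat_word_carrier:
  assumes A: "\<And>i. i < b \<Longrightarrow> A i \<in> carrier_mat r r" and w: "set w \<subseteq> {0..<b}"
  shows "mat_word r A w \<in> carrier_mat r r"
  using w
proof (induction w)
  case (Cons e w)
  then have "A e * mat_word r A w \<in> carrier_mat r r"
    using A[of e] by (intro mult_carrier_mat[of _ r r]) auto
  then show ?case by (simp add: mat_word_def)
qed (simp add: mat_word_def)

lemma mat_word_Cons_vec:
  assumes A: "\<And>i. i < b \<Longrightarrow> A i \<in> carrier_mat r r" and D: "D \<in> carrier_vec r"
    and w: "set (e # w) \<subseteq> {0..<b}"
  shows "mat_word r A (e # w) *\<^sub>v D = A e *\<^sub>v (mat_word r A w *\<^sub>v D)"
proof -
  have "mat_word r A (e # w) = A e * mat_word r A w" by (simp add: mat_word_def)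
  moreover have "mat_word r A w \<in> carrier_mat r r"
    by (rule mat_word_carrier[OF A]) (use w in auto)
  moreover have "A e \<in> carrier_mat r r" using A[of e] w by simp
  ultimately show ?thesis using D by simp
qed

lemma mat_sum_mult_vec:
  assumes A: "\<And>i. i < b \<Longrightarrow> A i \<in> carrier_mat r r" and D: "D \<in> carrier_vec r" and "i < r"
  shows "(mat_sum r b A *\<^sub>v D) $ i = (\<Sum>k<b. (A k *\<^sub>v D) $ i)"
proof -
  have "(mat_sum r b A *\<^sub>v D) $ i = (\<Sum>j<r. \<Sum>k<b. A k $$ (i, j) * D $ j)"
    using D \<open>i < r\<close> by (subst mult_mat_vec_nth[of _ r]) (auto simp: mat_sum_def sum_distrib_right)
  also have "\<dots> = (\<Sum>k<b. (A k *\<^sub>v D) $ i)"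
    by (subst sum.swap, intro sum.cong refl mult_mat_vec_nth[symmetric] A D \<open>i < r\<close>) auto
  finally show ?thesis .
qed

text \<open>
A formula \<open>u A\<^sub>w D\<close> with one matrix for every letter, including the first, becomes a linear
representation by absorbing the first matrix into the row vector: \<open>R\<^sub>i = u A\<^sub>i\<close>. Both measures of the
theorem have such a formula and differ only in \<open>u\<close>.
\<close>

lemma linearly_representable_row_vec:
  assumes r: "1 \<le> r"
    and A: "\<And>i. i < b \<Longrightarrow> A i \<in> carrier_mat r r" and A_nonneg: "\<And>i. i < b \<Longrightarrow> 0\<^sub>m r r \<le> A i"
    and D: "positive_vec r D" and fix_D: "mat_sum r b A *\<^sub>v D = D"
    and u: "u \<in> carrier_vec r" "0\<^sub>v r \<le> u" "u \<bullet> D = 1"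
    and \<nu>: "has_cylinder_values b f \<nu>"
    and f: "\<And>w. w \<noteq> [] \<Longrightarrow> set w \<subseteq> {0..<b} \<Longrightarrow> f w = u \<bullet> (mat_word r A w *\<^sub>v D)"
  shows "linearly_representable b \<nu>"
proof -
  have cD: "D \<in> carrier_vec r" using D by (simp add: positive_vec_def)
  define R where "R i = transpose_mat (A i) *\<^sub>v u" for i
  have R: "R i \<in> carrier_vec r" if "i < b" for i
    unfolding R_def using A[OF that] u by (intro mult_mat_vec_carrier[of _ r r]) auto
  have R_scalar: "R i \<bullet> v = u \<bullet> (A i *\<^sub>v v)" if "i < b" "v \<in> carrier_vec r" for i v
    using transpose_vec_mult_scalar[OF A[OF that(1)] that(2) u(1)] by (simp add: R_def)
  have "0\<^sub>v r \<le> R i" if "i < b" for i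
    using A[OF that] A_nonneg[OF that] u
    by (auto simp: R_def less_eq_vec_def less_eq_mat_def scalar_prod_def intro!: sum_nonneg mult_nonneg_nonneg)
  moreover have "vec_sum r b R \<bullet> D = 1"
  proof -
    have "vec_sum r b R \<bullet> D = (\<Sum>i<r. \<Sum>k<b. R k $ i * D $ i)"
      using cD by (simp add: scalar_prod_def vec_sum_def sum_distrib_right atLeast0LessThan)
    also have "\<dots> = (\<Sum>k<b. R k \<bullet> D)"
      using cD by (subst sum.swap) (simp add: scalar_prod_def atLeast0LessThan)
    also have "\<dots> = (\<Sum>k<b. \<Sum>i<r. u $ i * (A k *\<^sub>v D) $ i)"
      proof (intro sum.cong refl)
      fix k assume "k \<in> {..<b}"
      then show "R k \<bullet> D = (\<Sum>i<r. u $ i * (A k *\<^sub>v D) $ i)"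
        using A[of k] by (simp add: R_scalar cD, simp add: scalar_prod_def atLeast0LessThan)
    qed
    also have "\<dots> = (\<Sum>i<r. u $ i * (mat_sum r b A *\<^sub>v D) $ i)"
      by (subst sum.swap) (simp add: mat_sum_mult_vec[OF A cD] sum_distrib_left)
    also have "\<dots> = u \<bullet> D"
      using cD by (simp add: fix_D scalar_prod_def atLeast0LessThan)
    finally show ?thesis using u by simp
  qed
  moreover have "measure \<nu> (cylinder b w) = R (hd w) \<bullet> (mat_word r A (tl w) *\<^sub>v D)"
    if w: "w \<noteq> []" "set w \<subseteq> {0..<b}" for w
  proof -
    obtain e v where ev: "w = e # v" using w by (cases w) auto
    have v: "mat_word r A v \<in> carrier_mat r r"
      by (rule mat_word_carrier[OF A]) (use w ev in auto)
    have "measure \<nu> (cylinder b w) = u \<bullet> (mat_word r A w *\<^sub>v D)"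
      using \<nu> w f by (auto simp: has_cylinder_values_def)
    also have "\<dots> = u \<bullet> (A e *\<^sub>v (mat_word r A v *\<^sub>v D))"
      using mat_word_Cons_vec[OF A cD] w ev by simp
    also have "\<dots> = R e \<bullet> (mat_word r A v *\<^sub>v D)"
      using w ev v cD by (intro R_scalar[symmetric]) auto
    finally show ?thesis by (simp add: ev)
  qed
  ultimately show ?thesis
    unfolding linearly_representable_def
    using r A A_nonneg D fix_D R \<nu>
    by (intro conjI exI[of _ r] exI[of _ R] exI[of _ A] exI[of _ D])
       (auto simp: has_cylinder_values_def)
qed

section \<open>Self-similarity of the Bernoulli convolution\<close>

text \<open>
The index \<open>q\<close> is admissible exactly when it lies strictly below \<open>(d - 1) / (b - 1)\<close>, the largest value
of an expansion with digits below \<open>d\<close>.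
\<close>

lemma top_index_iff:
  assumes "2 \<le> b" "b \<le> d"
  shows "q \<le> top_index b d \<longleftrightarrow> (b - 1) * q < d - 1"
proof -
  have b: "0 < real b - 1" and d: "0 < real d - 1" using assms by auto
  then have "0 < (real d - 1) / (real b - 1)" by simp
  then have "0 \<le> \<lceil>(real d - 1) / (real b - 1)\<rceil> - 1" by linarith
  then have "q \<le> top_index b d \<longleftrightarrow> int q < \<lceil>(real d - 1) / (real b - 1)\<rceil>"
    unfolding top_index_def by linarith
  also have "\<dots> \<longleftrightarrow> real q < (real d - 1) / (real b - 1)"
    by (simp add: less_ceiling_iff)
  also have "\<dots> \<longleftrightarrow> real ((b - 1) * q) < real (d - 1)"
    using b assms by (simp add: pos_less_divide_eq mult.commute of_nat_diff)
  finally show ?thesis by (simp only: of_nat_less_iff)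
qed

definition adic_value :: "nat \<Rightarrow> (nat \<Rightarrow> nat) \<Rightarrow> real" where
  "adic_value b \<omega> = (\<Sum>k. real (\<omega> k) / real b ^ Suc k)"

locale digit_distribution =
  fixes b d :: nat and p :: "nat \<Rightarrow> real"
  assumes b_ge: "2 \<le> b" and b_le_d: "b \<le> d"
    and p_pos: "i < d \<Longrightarrow> 0 < p i" and p_sum: "(\<Sum>i<d. p i) = 1"
begin

abbreviation "\<eta> \<equiv> bernoulli_conv b d p"
abbreviation "a \<equiv> top_index b d"
abbreviation "digit_law \<equiv> point_measure {0..<d} (\<lambda>i. ennreal (p i))"

lemma digit_law_prob: "prob_space digit_law"
proof
  have "(\<Sum>i\<in>{0..<d}. ennreal (p i)) = ennreal (\<Sum>i\<in>{0..<d}. p i)"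
    by (intro sum_ennreal) (auto intro: less_imp_le p_pos)
  also have "\<dots> = 1" using p_sum by (simp add: atLeast0LessThan)
  finally show "emeasure digit_law (space digit_law) = 1"
    by (simp add: space_point_measure emeasure_point_measure_finite)
qed

sublocale sequence_space digit_law
  by (intro sequence_space.intro product_prob_space.intro product_prob_space_axioms.intro
      product_sigma_finite.intro digit_law_prob prob_space_imp_sigma_finite)

lemma digit_product_eq: "digit_product d p = S"
  by (simp add: digit_product_def)

lemma space_S: "space S = {\<omega>. \<forall>k. \<omega> k < d}"
  by (auto simp: space_PiM space_point_measure PiE_def Pi_def)

lemma digit_le:
  assumes "\<omega> \<in> space S"
  shows "real (\<omega> k) \<le> real d - 1"
proof -
  have "\<omega> k < d" using assms by (simp add: space_S)
  then have "real (\<omega> k) + 1 \<le> real d" by linarith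
  then show ?thesis by simp
qed

lemma max_digit_sums: "(\<lambda>k. (real d - 1) / real b ^ Suc k) sums ((real d - 1) / (real b - 1))"
proof -
  have b: "1 < real b" using b_ge by simp
  have "(\<lambda>k. (real d - 1) / real b * (1 / real b) ^ k) sums
      ((real d - 1) / real b * (1 / (1 - 1 / real b)))"
    using b by (intro sums_mult geometric_sums) auto
  also have "(\<lambda>k. (real d - 1) / real b * (1 / real b) ^ k) = (\<lambda>k. (real d - 1) / real b ^ Suc k)"
    by (simp add: power_divide)
  also have "(real d - 1) / real b * (1 / (1 - 1 / real b)) = (real d - 1) / (real b - 1)"
    using b by (simp add: divide_simps)
  finally show ?thesis .
qed

lemma adic_value_summable:
  assumes "\<omega> \<in> space S"
  shows "summable (\<lambda>k. real (\<omega> k) / real b ^ Suc k)"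
  using digit_le[OF assms]
  by (intro summable_comparison_test'[OF sums_summable[OF max_digit_sums], of 0])
     (auto intro!: divide_right_mono)

lemma adic_value_bounds:
  assumes "\<omega> \<in> space S"
  shows "0 \<le> adic_value b \<omega>" "adic_value b \<omega> \<le> (real d - 1) / (real b - 1)"
proof -
  show "0 \<le> adic_value b \<omega>"
    unfolding adic_value_def by (intro suminf_nonneg adic_value_summable[OF assms]) simp
  show "adic_value b \<omega> \<le> (real d - 1) / (real b - 1)"
    unfolding adic_value_def sums_unique[OF max_digit_sums]
    by (intro suminf_le adic_value_summable[OF assms] sums_summable[OF max_digit_sums]
        divide_right_mono digit_le[OF assms]) simp
qed

lemma adic_value_case_nat:
  assumes "\<omega> \<in> space S"
  shows "adic_value b (case_nat i \<omega>) = (real i + adic_value b \<omega>) / real b"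
proof -
  have b: "real b \<noteq> 0" using b_ge by simp
  have "(\<lambda>k. (real (\<omega> k) / real b ^ Suc k) / real b) sums (adic_value b \<omega> / real b)"
    unfolding adic_value_def by (intro sums_divide summable_sums adic_value_summable[OF assms])
  then have "(\<lambda>k. real (case_nat i \<omega> (Suc k)) / real b ^ Suc (Suc k)) sums (adic_value b \<omega> / real b)"
    by (simp add: mult.commute)
  from sums_Suc[where f = "\<lambda>k. real (case_nat i \<omega> k) / real b ^ Suc k", OF this]
  have "(\<lambda>k. real (case_nat i \<omega> k) / real b ^ Suc k) sums (adic_value b \<omega> / real b + real i / real b)"
    by simp
  then show ?thesis
    unfolding adic_value_def by (simp add: sums_iff add_divide_distrib)
qed

lemma adic_value_measurable [measurable]: "adic_value b \<in> borel_measurable S"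
proof -
  have "(\<lambda>\<omega>. real (\<omega> k)) \<in> borel_measurable S" for k
  proof -
    have "(\<lambda>\<omega>. \<omega> k) \<in> measurable S digit_law" by measurable
    moreover have "real \<in> measurable digit_law borel" by simp
    ultimately show ?thesis by (rule measurable_compose)
  qed
  then show ?thesis unfolding adic_value_def by measurable
qed

lemma bernoulli_conv_eq: "\<eta> = distr S borel (adic_value b)"
  by (simp add: bernoulli_conv_def digit_product_eq adic_value_def[abs_def])

lemma sets_eta [simp, measurable_cong]: "sets \<eta> = sets borel"
  and space_eta [simp]: "space \<eta> = UNIV"
  by (simp_all add: bernoulli_conv_eq)

sublocale eta: prob_space \<eta>
  unfolding bernoulli_conv_eq by (rule P.prob_space_distr) measurable

text \<open>
Splitting off the first digit \<open>i\<close> writes a random expansion as \<open>(i + y) / b\<close>, where \<open>y\<close> is an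
independent expansion with the same law. This self-similarity is the source of all matrix identities below.
\<close>

lemma bernoulli_conv_self_similar:
  assumes X [measurable]: "X \<in> sets borel"
  shows "measure \<eta> X = (\<Sum>i<d. p i * measure \<eta> {y. (real i + y) / real b \<in> X})"
proof -
  let ?T = "\<lambda>(s, \<omega>). case_nat s \<omega> :: nat \<Rightarrow> nat"
  let ?Y = "adic_value b -` X \<inter> space S"
  have Y: "?Y \<in> sets S" by measurable
  have T: "?T \<in> measurable (digit_law \<Otimes>\<^sub>M S) S"
    by (simp add: split_beta' measurable_case_nat')
  have cell: "emeasure S (Pair i -` (?T -` ?Y \<inter> space (digit_law \<Otimes>\<^sub>M S))) =
      ennreal (measure \<eta> {y. (real i + y) / real b \<in> X})" if i: "i < d" for i
  proof -
    have "Pair i -` (?T -` ?Y \<inter> space (digit_law \<Otimes>\<^sub>M S)) =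
        adic_value b -` {y. (real i + y) / real b \<in> X} \<inter> space S"
    proof (intro Set.set_eqI)
      fix \<omega>
      have "case_nat i \<omega> \<in> space S \<longleftrightarrow> \<omega> \<in> space S"
        using i by (auto simp: space_S split: nat.splits)
      then show "\<omega> \<in> Pair i -` (?T -` ?Y \<inter> space (digit_law \<Otimes>\<^sub>M S)) \<longleftrightarrow>
          \<omega> \<in> adic_value b -` {y. (real i + y) / real b \<in> X} \<inter> space S"
        using i adic_value_case_nat[of \<omega> i]
        by (auto simp: space_pair_measure space_point_measure)
    qed
    also have "emeasure S \<dots> = emeasure \<eta> {y. (real i + y) / real b \<in> X}"
      unfolding bernoulli_conv_eq by (subst emeasure_distr) auto
    finally show ?thesis by (simp add: eta.emeasure_eq_measure)
  qed
  have "emeasure \<eta> X = emeasure S ?Y"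
    unfolding bernoulli_conv_eq by (subst emeasure_distr) auto
  also have "\<dots> = emeasure (distr (digit_law \<Otimes>\<^sub>M S) S ?T) ?Y"
    by (simp only: PiM_iter)
  also have "\<dots> = emeasure (digit_law \<Otimes>\<^sub>M S) (?T -` ?Y \<inter> space (digit_law \<Otimes>\<^sub>M S))"
    by (rule emeasure_distr[OF T Y])
  also have "\<dots> = (\<integral>\<^sup>+ i. emeasure S (Pair i -` (?T -` ?Y \<inter> space (digit_law \<Otimes>\<^sub>M S))) \<partial>digit_law)"
    by (rule P.emeasure_pair_measure_alt) (rule measurable_sets[OF T Y])
  also have "\<dots> = (\<Sum>i\<in>{0..<d}. ennreal (p i) *
      emeasure S (Pair i -` (?T -` ?Y \<inter> space (digit_law \<Otimes>\<^sub>M S))))"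
    by (rule nn_integral_point_measure_finite) simp
  also have "\<dots> = (\<Sum>i\<in>{0..<d}. ennreal (p i * measure \<eta> {y. (real i + y) / real b \<in> X}))"
  proof (rule sum.cong[OF refl])
    fix i assume "i \<in> {0..<d}"
    then have "i < d" by simp
    then show "ennreal (p i) * emeasure S (Pair i -` (?T -` ?Y \<inter> space (digit_law \<Otimes>\<^sub>M S))) =
        ennreal (p i * measure \<eta> {y. (real i + y) / real b \<in> X})"
      using p_pos[of i] by (simp only: cell ennreal_mult' less_imp_le)
  qed
  also have "\<dots> = ennreal (\<Sum>i\<in>{0..<d}. p i * measure \<eta> {y. (real i + y) / real b \<in> X})"
    by (rule sum_ennreal) (auto intro!: mult_nonneg_nonneg less_imp_le[OF p_pos])
  finally have "ennreal (measure \<eta> X) =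
      ennreal (\<Sum>i\<in>{0..<d}. p i * measure \<eta> {y. (real i + y) / real b \<in> X})"
    by (simp add: eta.emeasure_eq_measure)
  then show ?thesis
    by (subst (asm) ennreal_inj)
       (auto intro!: sum_nonneg mult_nonneg_nonneg less_imp_le[OF p_pos] simp: atLeast0LessThan)
qed

section \<open>Support and masses of translated cells\<close>

lemma p_last_less_1: "p (d - 1) < 1"
proof -
  have "p 0 + p (d - 1) \<le> (\<Sum>i<d. p i)"
    using sum_mono2[of "{..<d}" "{0, d - 1}" p] b_ge b_le_d p_pos by (auto intro: less_imp_le)
  then show ?thesis using p_pos[of 0] p_sum b_ge b_le_d by simp
qed

text \<open>
The endpoint \<open>L = (d - 1) / (b - 1)\<close> must be excluded, since it is an integer for some \<open>b\<close> and \<open>d\<close>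
and would then be charged to an inadmissible translate. It is the fixed point of the branch
\<open>y \<mapsto> (d - 1 + y) / b\<close> and lies above the image of the support under every other branch, so self-similarity
gives \<open>\<eta> {L..} = p\<^sub>d\<^sub>-\<^sub>1 \<eta> {L..}\<close> with \<open>p\<^sub>d\<^sub>-\<^sub>1 < 1\<close>.
\<close>

lemma AE_support: "AE x in \<eta>. 0 \<le> x \<and> x < (real d - 1) / (real b - 1)"
proof -
  define L where "L = (real d - 1) / (real b - 1)"
  have b: "0 < real b - 1" "0 < real b" and d: "0 < d" using b_ge b_le_d by auto
  have L: "real b * L - (real d - 1) = L"
    using b by (simp add: L_def field_simps)
  have "AE \<omega> in S. 0 \<le> adic_value b \<omega> \<and> adic_value b \<omega> \<le> L"
    by (rule AE_I2) (use adic_value_bounds in \<open>auto simp: L_def\<close>)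
  then have bounds: "AE x in \<eta>. 0 \<le> x \<and> x \<le> L"
    unfolding bernoulli_conv_eq by (subst AE_distr_iff) auto
  have null: "measure \<eta> {y. (real i + y) / real b \<in> {L..}} = 0" if "i \<in> {..<d} - {d - 1}" for i
  proof -
    have "real i < real d - 1" using that d by auto
    then have "L < real b * L - real i" using L by linarith
    then have "AE y in \<eta>. y \<in> {y. (real i + y) / real b \<in> {L..}} \<longleftrightarrow> y \<in> {}"
      using bounds
    proof (elim AE_mp, intro AE_I2 impI)
      fix y assume "0 \<le> y \<and> y \<le> L"
      with \<open>L < real b * L - real i\<close> have "real i + y < L * real b"
        by (simp add: mult.commute)
      then have "(real i + y) / real b < L"
        using b by (simp add: pos_divide_less_eq)
      then show "y \<in> {y. (real i + y) / real b \<in> {L..}} \<longleftrightarrow> y \<in> {}" by simp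
    qed
    then have "measure \<eta> {y. (real i + y) / real b \<in> {L..}} = measure \<eta> {}"
      by (intro eta.finite_measure_eq_AE) auto
    then show ?thesis by simp
  qed
  have last: "{y. (real (d - 1) + y) / real b \<in> {L..}} = {L..}"
  proof -
    have "L \<le> (real (d - 1) + y) / real b \<longleftrightarrow> L \<le> y" for y
      using b d L by (simp add: pos_le_divide_eq of_nat_diff mult.commute) linarith
    then show ?thesis by (simp add: atLeast_def)
  qed
  have "measure \<eta> {L..} = (\<Sum>i<d. p i * measure \<eta> {y. (real i + y) / real b \<in> {L..}})"
    by (rule bernoulli_conv_self_similar) simp
  also have "\<dots> = p (d - 1) * measure \<eta> {y. (real (d - 1) + y) / real b \<in> {L..}} +
      (\<Sum>i\<in>{..<d} - {d - 1}. p i * measure \<eta> {y. (real i + y) / real b \<in> {L..}})"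
    by (rule sum.remove) (use d in auto)
  also have "\<dots> = p (d - 1) * measure \<eta> {L..}"
    unfolding last by (simp add: null del: atLeast_iff)
  finally have "measure \<eta> {L..} = 0" using p_last_less_1 by simp
  then have "AE x in \<eta>. x \<notin> {L..}"
    by (intro AE_not_in) (simp add: null_sets_def eta.emeasure_eq_measure)
  with bounds show ?thesis unfolding L_def[symmetric]
    by eventually_elim auto
qed

lemma measure_null:
  assumes "\<And>x. 0 \<le> x \<Longrightarrow> x < (real d - 1) / (real b - 1) \<Longrightarrow> x \<notin> X" and "X \<in> sets borel"
  shows "measure \<eta> X = 0"
proof -
  have "AE x in \<eta>. x \<in> X \<longleftrightarrow> x \<in> {}"
    using AE_support by eventually_elim (use assms in auto)
  then have "measure \<eta> X = measure \<eta> {}"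
    using assms by (intro eta.finite_measure_eq_AE) auto
  then show ?thesis by simp
qed

text \<open>
The shift \<open>m\<close> is an integer because the recursion subtracts digits and leaves the natural numbers;
the negative shifts, like those above \<open>a\<close>, carry no mass.
\<close>

definition cell_mass :: "int \<Rightarrow> nat list \<Rightarrow> real" where
  "cell_mass m w = measure \<eta> {x. x - real_of_int m \<in> adic_interval b w}"

lemma b_pos: "0 < b" using b_ge by simp

lemma translate_iff: "x \<in> translate q X \<longleftrightarrow> x - real q \<in> X"
  by (force simp: translate_def image_iff)

lemma translate_cell: "translate q (adic_interval b w) = {x. x - real_of_int (int q) \<in> adic_interval b w}"
  by (auto simp: translate_iff)

lemma measure_translate_cell: "measure \<eta> (translate q (adic_interval b w)) = cell_mass (int q) w"
  by (simp add: cell_mass_def translate_cell)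

lemma measure_translate_unit: "measure \<eta> (translate q {0..<1}) = cell_mass (int q) []"
  using measure_translate_cell[of q "[]"] by (simp add: cell_Nil)

lemma cell_mass_nonneg: "0 \<le> cell_mass m w"
  by (simp add: cell_mass_def)

lemma cell_mass_eq_0:
  assumes "set w \<subseteq> {0..<b}" "m < 0 \<or> int a < m"
  shows "cell_mass m w = 0"
  unfolding cell_mass_def
proof (rule measure_null)
  fix x assume x: "0 \<le> x" "x < (real d - 1) / (real b - 1)"
  show "x \<notin> {x. x - real_of_int m \<in> adic_interval b w}"
  proof
    assume "x \<in> {x. x - real_of_int m \<in> adic_interval b w}"
    then have m: "real_of_int m \<le> x" "x < real_of_int m + 1"
      using cell_unit[OF b_pos assms(1), of "x - real_of_int m"] by auto
    then have "0 \<le> m" using x by linarith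
    moreover have "nat m \<le> a"
    proof -
      have "real (nat m) < (real d - 1) / (real b - 1)" using m x \<open>0 \<le> m\<close> by simp
      then have "real ((b - 1) * nat m) < real (d - 1)"
        using b_ge b_le_d by (simp add: pos_less_divide_eq mult.commute of_nat_diff)
      then show ?thesis
        unfolding top_index_iff[OF b_ge b_le_d] by (simp only: of_nat_less_iff)
    qed
    ultimately show False using assms(2) by linarith
  qed
qed measurable

text \<open>
If the first random digit is \<open>i\<close>, the point \<open>(i + y) / b\<close> lies in the \<open>m\<close>-th translate of the cell of
\<open>e # w\<close> exactly when \<open>y\<close> lies in the translate of the cell of \<open>w\<close> by \<open>q' = e + b m - i\<close>.
Summing over \<open>q'\<close> instead of \<open>i\<close> produces row \<open>m\<close> of the digit matrix of \<open>e\<close>.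
\<close>

lemma cell_mass_Cons:
  assumes "set w \<subseteq> {0..<b}"
  shows "cell_mass m (e # w) =
    (\<Sum>q'<a + 1. prob_ext d p (int e + int b * m - int q') * cell_mass (int q') w)"
proof -
  define n where "n = int e + int b * m"
  have cell: "{y. (real i + y) / real b \<in> {x. x - real_of_int m \<in> adic_interval b (e # w)}} =
      {y. y - real_of_int (n - int i) \<in> adic_interval b w}" for i
  proof -
    have "real b * ((real i + y) / real b - real_of_int m) - real e = y - real_of_int (n - int i)" for y
      using b_pos by (simp add: n_def field_simps)
    then show ?thesis by (simp only: mem_Collect_eq cell_Cons[OF b_pos])
  qed
  have "cell_mass m (e # w) = (\<Sum>i<d. p i * cell_mass (n - int i) w)"
    unfolding cell_mass_def
    by (subst bernoulli_conv_self_similar) (simp_all only: cell, measurable)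
  also have "\<dots> = (\<Sum>i | i < d \<and> 0 \<le> n - int i \<and> n - int i \<le> int a. p i * cell_mass (n - int i) w)"
    by (rule sum.mono_neutral_right) (auto simp: cell_mass_eq_0[OF assms] not_le)
  also have "\<dots> = (\<Sum>q' | q' < a + 1 \<and> 0 \<le> n - int q' \<and> n - int q' < int d.
      prob_ext d p (n - int q') * cell_mass (int q') w)"
    by (rule sum.reindex_bij_witness[where i = "\<lambda>q'. nat (n - int q')" and j = "\<lambda>i. nat (n - int i)"])
       (auto simp: prob_ext_def)
  also have "\<dots> = (\<Sum>q'<a + 1. prob_ext d p (n - int q') * cell_mass (int q') w)"
    by (rule sum.mono_neutral_left) (auto simp: prob_ext_def)
  finally show ?thesis by (simp add: n_def)
qed

section \<open>The matrix recursion and its fixed vector\<close>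

abbreviation "M \<equiv> digit_mat b d p"
abbreviation "M_sum \<equiv> mat_sum (a + 1) b M"

definition cell_vec :: "nat list \<Rightarrow> real vec" where
  "cell_vec w = vec (a + 1) (\<lambda>q. cell_mass (int q) w)"

lemma M_carrier: "M j \<in> carrier_mat (a + 1) (a + 1)"
  and M_nonneg: "0\<^sub>m (a + 1) (a + 1) \<le> M j"
  using p_pos by (auto simp: digit_mat_def less_eq_mat_def prob_ext_def nat_less_iff intro!: less_imp_le)

lemma M_sum_carrier: "M_sum \<in> carrier_mat (a + 1) (a + 1)"
  by (simp add: mat_sum_def)

lemma M_sum_nth:
  assumes "q < a + 1" "q' < a + 1"
  shows "M_sum $$ (q, q') = (\<Sum>j<b. prob_ext d p (int j + int b * int q - int q'))"
  using assms by (simp add: mat_sum_def digit_mat_def)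

lemma prob_ext_nonneg: "0 \<le> prob_ext d p i"
  using p_pos by (auto simp: prob_ext_def nat_less_iff intro: less_imp_le)

lemma cell_vec_carrier: "cell_vec w \<in> carrier_vec (a + 1)"
  by (simp add: cell_vec_def)

lemma cell_vec_Cons:
  assumes "set w \<subseteq> {0..<b}"
  shows "cell_vec (e # w) = M e *\<^sub>v cell_vec w"
proof (rule eq_vecI)
  fix q assume "q < dim_vec (M e *\<^sub>v cell_vec w)"
  then have q: "q < a + 1" using M_carrier[of e] by simp
  then show "cell_vec (e # w) $ q = (M e *\<^sub>v cell_vec w) $ q"
    using mult_mat_vec_nth[OF M_carrier cell_vec_carrier q, of e w]
    by (simp add: cell_vec_def cell_mass_Cons[OF assms] digit_mat_def)
qed (use M_carrier[of e] in \<open>simp add: cell_vec_def\<close>)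

lemma cell_vec_eq_mat_word:
  assumes "set w \<subseteq> {0..<b}"
  shows "cell_vec w = mat_word (a + 1) M w *\<^sub>v cell_vec []"
  using assms
proof (induction w)
  case Nil
  then show ?case using cell_vec_carrier[of "[]"] by (simp add: mat_word_def)
next
  case (Cons e w)
  then show ?case
    using mat_word_Cons_vec[of b M "a + 1" "cell_vec []" e w, OF M_carrier cell_vec_carrier]
      cell_vec_Cons[of w e] by simp
qed

lemma cell_mass_split: "cell_mass m [] = (\<Sum>e<b. cell_mass m [e])"
proof -
  let ?X = "\<lambda>w. {x. x - real_of_int m \<in> adic_interval b w}"
  have iff: "y \<in> adic_interval b [e] \<longleftrightarrow> 0 \<le> y \<and> y < 1 \<and> adic_digit b y 0 = e" if "e < b" for e y
    using cell_iff_digits[OF b_pos, of "[e]" y] cell_unit[OF b_pos, of "[e]" y] that by auto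
  have "?X [] = (\<Union>e\<in>{..<b}. ?X [e])"
    using adic_digit_less[OF b_pos] by (auto simp: iff cell_Nil)
  moreover have "disjoint_family_on (\<lambda>e. ?X [e]) {..<b}"
    by (auto simp: disjoint_family_on_def iff)
  ultimately show ?thesis
    unfolding cell_mass_def
    by (simp only:) (rule eta.finite_measure_finite_Union, auto)
qed

text \<open>
The unit interval is the disjoint union of its \<open>b\<close> cells of length one, and the digit matrices map
the masses of the unit intervals to the masses of these cells.
\<close>

lemma M_sum_cell_vec: "M_sum *\<^sub>v cell_vec [] = cell_vec []"
proof (rule eq_vecI)
  fix q assume "q < dim_vec (cell_vec [])"
  then have q: "q < a + 1" by (simp add: cell_vec_def)
  have "(M_sum *\<^sub>v cell_vec []) $ q = (\<Sum>e<b. (M e *\<^sub>v cell_vec []) $ q)"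
    by (rule mat_sum_mult_vec[OF M_carrier cell_vec_carrier q])
  also have "\<dots> = (\<Sum>e<b. cell_mass (int q) [e])"
    using q by (intro sum.cong refl) (simp only: cell_vec_Cons[of "[]", symmetric] list.set
        empty_subsetI, simp add: cell_vec_def)
  finally show "(M_sum *\<^sub>v cell_vec []) $ q = cell_vec [] $ q"
    using q by (simp add: cell_mass_split[symmetric] cell_vec_def)
qed (simp add: cell_vec_def mat_sum_def)

text \<open>
The points with a given digit prefix form the union of all integer translates of one cell, of which only
those with shift in \<open>{0..a}\<close> carry mass.
\<close>

lemma measure_digits_in_cylinder:
  assumes w: "set w \<subseteq> {0..<b}"
  shows "measure \<eta> {x. adic_digit b x \<in> cylinder b w} = (\<Sum>q<a + 1. cell_mass (int q) w)"
    and "(\<Sum>q. cell_mass (int q) w) = (\<Sum>q<a + 1. cell_mass (int q) w)"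
proof -
  let ?X = "\<lambda>q::nat. {x. x - real_of_int (int q) \<in> adic_interval b w}"
  note meas = digits_in_cylinder_borel[OF b_pos, of w]
  have *: "(\<Sum>q. cell_mass (int q) w) = (\<Sum>q<a + 1. cell_mass (int q) w)"
    by (rule suminf_finite) (auto intro: cell_mass_eq_0[OF w])
  have disj: "disjoint_family ?X"
    unfolding disjoint_family_on_def
  proof safe
    fix q q' :: nat and x
    assume "q \<noteq> q'" and x: "x - real_of_int (int q) \<in> adic_interval b w"
      "x - real_of_int (int q') \<in> adic_interval b w"
    from cell_unit[OF b_pos w x(1)] cell_unit[OF b_pos w x(2)] have "q = q'" by simp
    with \<open>q \<noteq> q'\<close> show "x \<in> {}" by simp
  qed
  have "(\<lambda>q. measure \<eta> (?X q)) sums measure \<eta> (\<Union>q. ?X q)"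
    by (rule eta.finite_measure_UNION[OF _ disj]) auto
  then have sum_eq: "measure \<eta> (\<Union>q. ?X q) = (\<Sum>q<a + 1. cell_mass (int q) w)"
    unfolding *[symmetric] by (simp add: sums_iff cell_mass_def)
  have "AE x in \<eta>. x \<in> {x. adic_digit b x \<in> cylinder b w} \<longleftrightarrow> x \<in> (\<Union>q. ?X q)"
    using AE_support
  proof eventually_elim
    case (elim x)
    have "x \<in> {x. adic_digit b x \<in> cylinder b w} \<longleftrightarrow> (\<exists>m::int. x - of_int m \<in> adic_interval b w)"
      using digits_in_cylinder_iff(1)[OF b_pos w] by simp
    also have "\<dots> \<longleftrightarrow> (\<exists>q::nat. x - real_of_int (int q) \<in> adic_interval b w)"
    proof
      assume "\<exists>m::int. x - of_int m \<in> adic_interval b w"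
      then obtain m :: int where m: "x - of_int m \<in> adic_interval b w" by blast
      then have "0 \<le> m" using cell_unit[OF b_pos w m] elim by linarith
      then show "\<exists>q::nat. x - real_of_int (int q) \<in> adic_interval b w"
        using m by (intro exI[of _ "nat m"]) simp
    qed blast
    finally show ?case by simp
  qed
  then have "measure \<eta> {x. adic_digit b x \<in> cylinder b w} = measure \<eta> (\<Union>q. ?X q)"
    using meas by (intro eta.finite_measure_eq_AE) auto
  with sum_eq show "measure \<eta> {x. adic_digit b x \<in> cylinder b w} = (\<Sum>q<a + 1. cell_mass (int q) w)"
    by simp
  show "(\<Sum>q. cell_mass (int q) w) = (\<Sum>q<a + 1. cell_mass (int q) w)" by (rule *)
qed

lemma cell_vec_sum: "(\<Sum>q<a + 1. cell_vec [] $ q) = 1"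
proof -
  have "{x. adic_digit b x \<in> cylinder b []} = UNIV"
    using adic_digit_less[OF b_pos] by (auto simp: cylinder_def space_symb_space)
  then have "(\<Sum>q<a + 1. cell_mass (int q) []) = 1"
    using measure_digits_in_cylinder(1)[of "[]"] eta.prob_space by simp
  then show ?thesis by (simp add: cell_vec_def)
qed

text \<open>
The entry at \<open>(q, q')\<close> sums the weights of the digits of the form \<open>j + b q - q'\<close>. Near the diagonal one of
these is a legal digit: the bound \<open>(b - 1) q < d - 1\<close> is just enough for \<open>q' = q - 1\<close>, where
the digit is \<open>(b - 1) q + 1\<close>.
\<close>

lemma M_sum_irreducible: "irreducible_mat (a + 1) M_sum"
proof (rule irreducible_mat_band[OF M_sum_carrier])
  show "0\<^sub>m (a + 1) (a + 1) \<le> M_sum"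
    using M_sum_carrier by (auto simp: less_eq_mat_def M_sum_nth[simplified] intro!: sum_nonneg prob_ext_nonneg)
next
  fix q q' assume q: "q < a + 1" "q' < a + 1" "q \<le> Suc q'" "q' \<le> Suc q"
  \<comment> \<open>above the diagonal \<open>j = 0\<close> would give the digit \<open>(b - 1) q - 1\<close>, negative for \<open>q = 0\<close>\<close>
  define j where "j = (if q' = Suc q then 1 else 0 :: nat)"
  have j: "j < b" using b_ge by (simp add: j_def)
  define n where "n = int j + int b * int q - int q'"
  obtain c where c: "b = Suc c" "1 \<le> c" using b_ge by (cases b) auto
  have "c * q < d - 1" using top_index_iff[OF b_ge b_le_d, of q] q c by simp
  then have "int (c * q) < int d - 1" by linarith
  moreover have "q' = q \<or> q' = Suc q \<or> q = Suc q'" using q by linarith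
  ultimately have "0 \<le> n" "n < int d"
    using c by (auto simp: n_def j_def algebra_simps)
  then have "0 < prob_ext d p n" by (simp add: prob_ext_def p_pos nat_less_iff)
  also have "\<dots> \<le> (\<Sum>j<b. prob_ext d p (int j + int b * int q - int q'))"
    unfolding n_def using j
    by (intro member_le_sum[where f = "\<lambda>j. prob_ext d p (int j + int b * int q - int q')"])
       (auto intro: prob_ext_nonneg)
  finally show "0 < M_sum $$ (q, q')" by (simp only: M_sum_nth[OF q(1,2)])
qed

text \<open>
As \<open>q\<close> and \<open>j\<close> vary, \<open>j + b q\<close> runs once through all numbers below \<open>b (a + 1)\<close>; since
\<open>(b - 1) (a + 1) \<ge> d - 1\<close>, these include \<open>q' + i\<close> for every digit \<open>i\<close>, so a column collects the
whole probability vector.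
\<close>

lemma M_sum_column:
  assumes q': "q' < a + 1"
  shows "(\<Sum>q<a + 1. M_sum $$ (q, q')) = 1"
proof -
  define g where "g n = prob_ext d p (int n - int q')" for n
  have inner: "M_sum $$ (q, q') = sum g {q * b..<q * b + b}" if "q < a + 1" for q
  proof -
    have "M_sum $$ (q, q') = (\<Sum>j<b. g (j + q * b))"
      unfolding M_sum_nth[OF that q'] by (simp add: g_def mult.commute)
    also have "\<dots> = sum g {q * b..<q * b + b}"
      by (simp add: sum.shift_bounds_nat_ivl[of g 0 "q * b" b, simplified] atLeast0LessThan add.commute)
    finally show ?thesis .
  qed
  have "(\<Sum>q<a + 1. M_sum $$ (q, q')) = (\<Sum>q<a + 1. sum g {q * b..<q * b + b})"
    by (intro sum.cong refl inner) simp
  also have "\<dots> = sum g {..<(a + 1) * b}"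
    by (rule sum.nat_group)
  also have "\<dots> = (\<Sum>n\<in>{q'..<q' + d}. g n)"
  proof (rule sum.mono_neutral_right)
    have "\<not> a + 1 \<le> a" by simp
    then have "d - 1 \<le> (b - 1) * (a + 1)"
      unfolding top_index_iff[OF b_ge b_le_d, of "a + 1"] by simp
    moreover have "(b - 1) * (a + 1) + (a + 1) = (a + 1) * b"
      using b_pos by (cases b) auto
    ultimately have "d + a \<le> (a + 1) * b" by linarith
    then show "{q'..<q' + d} \<subseteq> {..<(a + 1) * b}" using q' by auto
  qed (auto simp: g_def prob_ext_def)
  also have "\<dots> = (\<Sum>i<d. g (i + q'))"
    using sum.shift_bounds_nat_ivl[of g 0 q' d] by (simp add: atLeast0LessThan add.commute)
  also have "\<dots> = 1"
    using p_sum by (simp add: g_def prob_ext_def)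
  finally show ?thesis .
qed

lemma cell_vec_positive: "positive_vec (a + 1) (cell_vec [])"
  unfolding positive_vec_def
proof (intro conjI allI impI cell_vec_carrier)
  fix q assume q: "q < a + 1"
  have nonneg: "0 \<le> cell_vec [] $ i" if "i < a + 1" for i
    using that by (simp add: cell_vec_def cell_mass_nonneg)
  obtain j where "j < a + 1" "cell_vec [] $ j \<noteq> 0"
    using cell_vec_sum by (metis (no_types, lifting) lessThan_iff sum.neutral zero_neq_one)
  with nonneg[of j] show "0 < cell_vec [] $ q"
    by (intro irreducible_fixed_vec_pos[OF M_sum_irreducible cell_vec_carrier M_sum_cell_vec nonneg _ _ q])
       auto
qed

lemma normalized_eigenvector_iff:
  "normalized_positive_eigenvector (a + 1) M_sum C \<longleftrightarrow> C = cell_vec []"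
proof -
  have unit: "(\<Sum>i<a + 1. unit_vec (a + 1) i \<bullet> v) = (\<Sum>i<a + 1. v $ i)"
    if "v \<in> carrier_vec (a + 1)" for v :: "real vec"
    using that by (intro sum.cong) auto
  show ?thesis
  proof
    assume C: "normalized_positive_eigenvector (a + 1) M_sum C"
    then obtain l where l: "positive_vec (a + 1) C" "eigenvector M_sum C l"
      "(\<Sum>i<a + 1. unit_vec (a + 1) i \<bullet> C) = 1"
      unfolding normalized_positive_eigenvector_def by blast
    then have carrier: "C \<in> carrier_vec (a + 1)" by (simp add: positive_vec_def)
    have sum_C: "(\<Sum>i<a + 1. C $ i) = 1" using l(3) unit[OF carrier] by simp
    then have "M_sum *\<^sub>v C = C"
      by (intro column_stochastic_eigenvalue[OF M_sum_carrier M_sum_column carrier _ l(2)]) auto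
    then show "C = cell_vec []"
      using irreducible_fixed_vec_unique[OF M_sum_irreducible] l(1) sum_C cell_vec_positive
        M_sum_cell_vec cell_vec_sum by blast
  next
    assume C: "C = cell_vec []"
    have "cell_vec [] $ 0 \<noteq> 0" using cell_vec_positive by (auto simp: positive_vec_def)
    then have "cell_vec [] \<noteq> 0\<^sub>v (a + 1)" by auto
    then have "eigenvector M_sum (cell_vec []) 1"
      using M_sum_carrier cell_vec_carrier M_sum_cell_vec by (auto simp: eigenvector_def)
    then show "normalized_positive_eigenvector (a + 1) M_sum C"
      using cell_vec_positive cell_vec_sum unit[OF cell_vec_carrier]
      by (auto simp: normalized_positive_eigenvector_def C)
  qed
qed

lemma measure_translate_unit_pos: "0 < measure \<eta> (translate q {0..<1}) \<longleftrightarrow> q \<le> a"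
proof (cases "q \<le> a")
  case True
  then show ?thesis
    using cell_vec_positive by (auto simp: positive_vec_def cell_vec_def measure_translate_unit)
next
  case False
  then show ?thesis using cell_mass_eq_0[of "[]" "int q"] by (simp add: measure_translate_unit)
qed

section \<open>The symbolic measures\<close>

text \<open>
The measure is the law of the digits of a point drawn from \<open>\<eta>\<close> conditioned on the translated unit interval.
\<close>

lemma has_eta_q_values:
  assumes q: "q \<le> a"
  shows "\<exists>\<nu>. has_cylinder_values b (eta_q_values b d p q) \<nu>"
proof -
  let ?U = "translate q {0..<1}"
  have U: "?U \<in> sets borel"
  proof -
    have "?U = {real q..<real q + 1}" by (auto simp: translate_iff)
    then show ?thesis by simp
  qed
  have U_pos: "emeasure \<eta> ?U \<noteq> 0" "emeasure \<eta> ?U \<noteq> \<infinity>"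
    using measure_translate_unit_pos[of q] q by (auto simp: eta.emeasure_eq_measure)
  have "measure (uniform_measure \<eta> ?U) {x. adic_digit b x \<in> cylinder b w} = eta_q_values b d p q w"
    if w: "w \<noteq> []" "set w \<subseteq> {0..<b}" for w
  proof -
    note meas = digits_in_cylinder_borel[OF b_pos, of w]
    have "?U \<inter> {x. adic_digit b x \<in> cylinder b w} = translate q (adic_interval b w)"
    proof (intro Set.set_eqI)
      fix x
      have "x \<in> ?U \<and> adic_digit b x \<in> cylinder b w \<longleftrightarrow>
          x - real q \<in> adic_interval b w"
        using digits_in_cylinder_iff(2)[OF b_pos w(2), of "int q" x]
          cell_unit[OF b_pos w(2), of "x - real q"] by (auto simp: translate_iff)
      then show "x \<in> ?U \<inter> {x. adic_digit b x \<in> cylinder b w} \<longleftrightarrow> x \<in> translate q (adic_interval b w)"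
        by (simp add: translate_iff)
    qed
    then show ?thesis
      using meas by (simp add: measure_uniform_measure[OF U_pos] eta_q_values_def)
  qed
  then have "has_cylinder_values b (eta_q_values b d p q)
      (distr (uniform_measure \<eta> ?U) (symb_space b) (adic_digit b))"
    by (intro has_cylinder_values_distr_digits b_pos prob_space_uniform_measure U_pos) auto
  then show ?thesis by blast
qed

lemma eta_sum_values_eq:
  assumes "set w \<subseteq> {0..<b}"
  shows "eta_sum_values b d p w = (\<Sum>q<a + 1. cell_mass (int q) w)"
  using measure_digits_in_cylinder(2)[OF assms] by (simp add: eta_sum_values_def measure_translate_cell)

text \<open>
Without conditioning, the digits of an \<open>\<eta>\<close>-random point have the summed cylinder values.
\<close>

lemma has_eta_sum_values: "\<exists>\<nu>. has_cylinder_values b (eta_sum_values b d p) \<nu>"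
  using has_cylinder_values_distr_digits[OF b_pos eta.prob_space_axioms sets_eta,
      of "eta_sum_values b d p"]
  by (auto simp: eta_sum_values_eq measure_digits_in_cylinder(1))

text \<open>
This covers both symbolic measures: \<open>u\<close> will be a multiple of a unit vector for a single translate
and the all-ones vector for the sum.
\<close>

lemma cylinder_measure_representable:
  assumes ex: "\<exists>\<nu>. has_cylinder_values b f \<nu>"
    and u: "u \<in> carrier_vec (a + 1)" "0\<^sub>v (a + 1) \<le> u" "u \<bullet> cell_vec [] = 1"
    and f: "\<And>w. set w \<subseteq> {0..<b} \<Longrightarrow> f w = u \<bullet> cell_vec w"
  shows "(\<exists>!\<nu>. has_cylinder_values b f \<nu>) \<and> linearly_representable b (cylinder_measure b f)"
proof
  show ex1: "\<exists>!\<nu>. has_cylinder_values b f \<nu>"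
    using ex has_cylinder_values_unique by blast
  have nu: "has_cylinder_values b f (cylinder_measure b f)"
    unfolding cylinder_measure_def by (rule theI'[OF ex1])
  show "linearly_representable b (cylinder_measure b f)"
  proof (rule linearly_representable_row_vec[OF _ M_carrier M_nonneg cell_vec_positive
        M_sum_cell_vec u nu])
    show "f w = u \<bullet> (mat_word (a + 1) M w *\<^sub>v cell_vec [])" if "set w \<subseteq> {0..<b}" for w
      unfolding cell_vec_eq_mat_word[OF that, symmetric] by (rule f[OF that])
  qed simp
qed

lemma eta_q_representable:
  assumes q: "q \<le> a"
  shows "(\<exists>!\<nu>. has_cylinder_values b (eta_q_values b d p q) \<nu>)
    \<and> linearly_representable b (eta_q_symb b d p q)"
  unfolding eta_q_symb_def
proof (rule cylinder_measure_representable[OF has_eta_q_values[OF q]])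
  define c where "c = cell_mass (int q) []"
  have c: "0 < c" using measure_translate_unit_pos[of q] q by (simp add: c_def measure_translate_unit)
  let ?u = "(1 / c) \<cdot>\<^sub>v unit_vec (a + 1) q"
  have scalar: "?u \<bullet> cell_vec w = cell_mass (int q) w / c" for w
    using q scalar_prod_left_unit[OF cell_vec_carrier, of q w]
    by (simp add: cell_vec_def)
  show "?u \<in> carrier_vec (a + 1)" by simp
  show "0\<^sub>v (a + 1) \<le> ?u" using c by (auto simp: less_eq_vec_def unit_vec_def)
  show "?u \<bullet> cell_vec [] = 1" unfolding scalar using c by (simp add: c_def[symmetric])
  show "eta_q_values b d p q w = ?u \<bullet> cell_vec w" for w
    unfolding scalar by (simp add: eta_q_values_def measure_translate_cell measure_translate_unit c_def)
qed

lemma eta_sum_representable: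
  "(\<exists>!\<nu>. has_cylinder_values b (eta_sum_values b d p) \<nu>)
    \<and> linearly_representable b (eta_sum_symb b d p)"
  unfolding eta_sum_symb_def
proof (rule cylinder_measure_representable[OF has_eta_sum_values])
  let ?u = "vec (a + 1) (\<lambda>_. 1) :: real vec"
  have scalar: "?u \<bullet> cell_vec w = (\<Sum>q<a + 1. cell_mass (int q) w)" for w
    by (simp add: scalar_prod_def cell_vec_def atLeast0LessThan)
  show "?u \<in> carrier_vec (a + 1)" by simp
  show "0\<^sub>v (a + 1) \<le> ?u" by (auto simp: less_eq_vec_def)
  show "?u \<bullet> cell_vec [] = 1" unfolding scalar using cell_vec_sum by (simp add: cell_vec_def)
  show "eta_sum_values b d p w = ?u \<bullet> cell_vec w" if "set w \<subseteq> {0..<b}" for w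
    unfolding scalar by (rule eta_sum_values_eq[OF that])
qed

lemma measure_cell_eq_mat_word:
  assumes "q \<le> a" "set w \<subseteq> {0..<b}"
  shows "measure \<eta> (translate q (adic_interval b w)) =
    unit_vec (a + 1) q \<bullet> (mat_word (a + 1) M w *\<^sub>v cell_vec [])"
  unfolding cell_vec_eq_mat_word[OF assms(2), symmetric] measure_translate_cell
  using assms(1) scalar_prod_left_unit[OF cell_vec_carrier, of q w] by (simp add: cell_vec_def)

end

section \<open>Matrix formula and linear representability\<close>

theorem theorem17:
  fixes b d :: nat and p :: "nat \<Rightarrow> real"
  assumes "2 \<le> b" and "b \<le> d"
    and "\<forall>i<d. 0 < p i" and "(\<Sum>i<d. p i) = 1"
  shows "irreducible_mat (top_index b d + 1) (mat_sum (top_index b d + 1) b (digit_mat b d p))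
    \<and> (\<exists>!C. normalized_positive_eigenvector (top_index b d + 1)
          (mat_sum (top_index b d + 1) b (digit_mat b d p)) C)
    \<and> (\<forall>C. normalized_positive_eigenvector (top_index b d + 1)
          (mat_sum (top_index b d + 1) b (digit_mat b d p)) C \<longrightarrow>
        (\<forall>q\<le>top_index b d. \<forall>\<epsilon>. \<epsilon> \<noteq> [] \<and> set \<epsilon> \<subseteq> {0..<b} \<longrightarrow>
          measure (bernoulli_conv b d p) (translate q (adic_interval b \<epsilon>)) =
            unit_vec (top_index b d + 1) q
              \<bullet> (mat_word (top_index b d + 1) (digit_mat b d p) \<epsilon> *\<^sub>v C)))
    \<and> (\<forall>q. 0 < measure (bernoulli_conv b d p) (translate q {0..<1}) \<longleftrightarrow> q \<le> top_index b d)
    \<and> (\<forall>q\<le>top_index b d.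
        (\<exists>!\<nu>. has_cylinder_values b (eta_q_values b d p q) \<nu>)
        \<and> linearly_representable b (eta_q_symb b d p q))
    \<and> (\<exists>!\<nu>. has_cylinder_values b (eta_sum_values b d p) \<nu>)
    \<and> linearly_representable b (eta_sum_symb b d p)"
proof -
  interpret digit_distribution b d p
    using assms by unfold_locales auto
  show ?thesis
    unfolding normalized_eigenvector_iff
    using M_sum_irreducible measure_cell_eq_mat_word measure_translate_unit_pos
      eta_q_representable eta_sum_representable
    by blast
qed

end
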